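(* Let $N,k$ be integers with $1\le k\le N$, and write points of $\mathbb{R}^N$ as $x=(y,z)\in\mathbb{R}^k\times\mathbb{R}^{N-k}$. Let $1<p<\infty$ and let $\alpha\in\mathbb{R}$ satisfy $\alpha+k>0$. Then for each $u\in\mathcal{D}(\mathbb{R}^N)$, $$\int_{\mathbb{R}^N}|u(x)|^p\,|y|^{\alpha}\,dx\ \le\ \frac{p^p}{(\alpha+k)^p}\int_{\mathbb{R}^N}|\nabla u(x)|^p\,|y|^{\alpha+p}\,dx .$$ Moreover, the constant $\frac{p^p}{(\alpha+k)^p}$ is optimal, i.e. the inequality does not hold for all $u\in\mathcal{D}(\mathbb{R}^N)$ if this constant is replaced by any smaller one.
   Context: $\mathcal{D}(\mathbb{R}^N)$ denotes the space of test functions, i.e. the $C^\infty$ functions on $\mathbb{R}^N$ with compact support. Integrals are with respect to Lebesgue measure, and $|\cdot|$ is the Euclidean norm. When $k=N$ the variable $z$ is absent and $y=x$. *)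

theory Defs
  imports "HOL-Analysis.Analysis"
begin

definition partial_deriv :: "'n::finite \<Rightarrow> (real ^ 'n \<Rightarrow> real) \<Rightarrow> real ^ 'n \<Rightarrow> real" where
  "partial_deriv i u x = frechet_derivative u (at x) (axis i 1)"

definition gradient :: "(real ^ 'n::finite \<Rightarrow> real) \<Rightarrow> real ^ 'n \<Rightarrow> real ^ 'n" where
  "gradient u x = (\<chi> i. partial_deriv i u x)"

primrec C_k :: "nat \<Rightarrow> (real ^ 'n::finite \<Rightarrow> real) \<Rightarrow> bool" where
  "C_k 0 u \<longleftrightarrow> continuous_on UNIV u"
| "C_k (Suc m) u \<longleftrightarrow> (\<forall>x. u differentiable (at x)) \<and> (\<forall>i. C_k m (partial_deriv i u))"

definition test_function :: "(real ^ 'n::finite \<Rightarrow> real) \<Rightarrow> bool" where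
  "test_function u \<longleftrightarrow> (\<forall>m. C_k m u) \<and> compact (closure {x. u x \<noteq> 0})"

text \<open>
  The splitting \<open>x = (y, z)\<close> is encoded by the set \<open>S\<close> of the coordinates that make up \<open>y\<close>
  (so \<open>k = card S\<close>, and \<open>z\<close> is absent when \<open>S = UNIV\<close>): an index type carries no order in
  which to take the first \<open>k\<close> coordinates. \<open>ynorm S x\<close> is the Euclidean norm of \<open>y\<close>.
\<close>

definition ynorm :: "'n::finite set \<Rightarrow> real ^ 'n \<Rightarrow> real" where
  "ynorm S x = L2_set (\<lambda>i. x $ i) S"

text \<open>
  The integrals are of nonnegative functions and are taken in \<open>[0, \<infinity>]\<close>, so no integrability
  side condition is needed. The value of \<open>powr\<close> at \<open>0\<close> is \<open>0\<close> for every exponent; this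
  concerns the weights only on the null set \<open>y = 0\<close>.
\<close>

definition weighted_integral ::
    "'n::finite set \<Rightarrow> real \<Rightarrow> real \<Rightarrow> (real ^ 'n \<Rightarrow> 'b::real_normed_vector) \<Rightarrow> ennreal" where
  "weighted_integral S p \<beta> f = (\<integral>\<^sup>+ x. ennreal (norm (f x) powr p * ynorm S x powr \<beta>) \<partial>lborel)"

end

theory Submission
  imports Defs
begin

text \<open>
  Put \<open>k = card S\<close> and \<open>b = (\<alpha> + k) / p\<close>, so that the constant is \<open>b\<close> to the power \<open>-p\<close>. Everything rests
  on the dilations \<open>D\<^sub>t (y, z) = (t y, z)\<close>, which multiply Lebesgue measure by \<open>t ^ k\<close>
  (\<open>nn_integral_dilate\<close>).

  \<^emph>\<open>The inequality.\<close> Let \<open>G x = \<bar>\<nabla>u x\<bar> \<bar>y\<bar>\<close>. Since \<open>u\<close> vanishes far out along the ray \<open>s \<mapsto> D\<^sub>t x\<close>,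
  \<open>t = exp s\<close>, integrating its derivative along the ray bounds \<open>\<bar>u x\<bar>\<close> by the integral of \<open>G (D\<^sub>t x)\<close>
  over \<open>s \<ge> 0\<close> (\<open>abs_le_integral_along_ray\<close>). Write this integral as the mean of \<open>exp (b s) G (D\<^sub>t x) / b\<close>
  with respect to the probability density \<open>b exp (- b s)\<close> and apply Jensen's inequality for the
  \<open>p\<close>-th power (\<open>powr_le_weighted_mean_powr\<close>). Now integrate over \<open>x\<close> against \<open>\<bar>y\<bar> powr \<alpha>\<close>: the dilation
  produces the factor \<open>exp (- (\<alpha> + k) s)\<close>, which cancels \<open>exp (b s) powr p\<close> exactly, and the density
  integrates to \<open>1\<close>. What remains is the right-hand side.

  \<^emph>\<open>Optimality.\<close> The formal extremal \<open>\<bar>y\<bar> powr - b\<close> turns the estimate into an equality, but both sides are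
  infinite. Take instead \<open>u\<^sub>\<epsilon> = (\<epsilon> + \<bar>y\<bar>\<^sup>2) powr (- b / 2) * \<chi>\<close> with a fixed smooth cut-off \<open>\<chi>\<close>. The
  part of \<open>\<nabla>u\<^sub>\<epsilon>\<close> in which the power is differentiated satisfies \<open>\<bar>y\<bar> \<bar>\<dots>\<bar> \<le> b u\<^sub>\<epsilon>\<close>; the part with \<open>\<nabla>\<chi>\<close>
  contributes at most a multiple of the integral of \<open>\<bar>y\<bar> powr (p - k)\<close> over a ball, finite and
  independent of \<open>\<epsilon>\<close> (\<open>near_extremal_energy\<close>). As \<open>\<epsilon>\<close> tends to \<open>0\<close> the left-hand side
  exceeds all bounds, because \<open>\<bar>y\<bar> powr - k\<close> is not integrable at \<open>y = 0\<close> (\<open>near_extremal_unbounded\<close>).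
  Hence the first part dominates and forces the constant to be at least \<open>b powr - p\<close>.
\<close>

section \<open>Gradients and smooth functions\<close>

lemma gradient_eqI:
  assumes "(u has_derivative (\<lambda>h. v \<bullet> h)) (at x)"
  shows "gradient u x = v"
proof -
  have "frechet_derivative u (at x) = (\<lambda>h. v \<bullet> h)"
    using frechet_derivative_at[OF assms] by simp
  then show ?thesis
    by (simp add: gradient_def partial_deriv_def vec_eq_iff inner_axis)
qed

lemma has_derivative_gradient:
  fixes u :: "real ^ 'n::finite \<Rightarrow> real"
  assumes "u differentiable (at x)"
  shows "(u has_derivative (\<lambda>h. gradient u x \<bullet> h)) (at x)"
proof -
  let ?D = "frechet_derivative u (at x)"
  have D: "(u has_derivative ?D) (at x)"
    using assms by (simp add: frechet_derivative_works)
  then have lin: "linear ?D" by (rule has_derivative_linear)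
  have "?D h = gradient u x \<bullet> h" for h
  proof -
    have "?D h = ?D (\<Sum>i\<in>UNIV. (h $ i) *\<^sub>R axis i 1)"
      using basis_expansion[of h] by (simp add: scalar_mult_eq_scaleR)
    also have "\<dots> = (\<Sum>i\<in>UNIV. (h $ i) * ?D (axis i 1))"
      using lin by (simp add: linear_sum linear_scale)
    also have "\<dots> = gradient u x \<bullet> h"
      by (simp add: gradient_def partial_deriv_def inner_vec_def mult.commute)
    finally show ?thesis .
  qed
  then show ?thesis using D by (metis (no_types, lifting) ext)
qed

lemma partial_derivI:
  assumes "(u has_derivative (\<lambda>h. v \<bullet> h)) (at x)"
  shows "partial_deriv i u x = v $ i"
  using gradient_eqI[OF assms] by (simp add: gradient_def vec_eq_iff)

lemma gradient_nth: "gradient u x $ i = partial_deriv i u x"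
  by (simp add: gradient_def)

lemma C_k_differentiable: "C_k (Suc m) u \<Longrightarrow> u differentiable (at x)"
  by simp

lemma C_k_SucD: "C_k (Suc m) u \<Longrightarrow> C_k m u"
proof (induction m arbitrary: u)
  case 0
  then show ?case
    by (auto intro!: continuous_at_imp_continuous_on differentiable_imp_continuous_within)
qed auto

lemma gradient_add:
  assumes "u differentiable (at x)" "v differentiable (at x)"
  shows "gradient (\<lambda>x. u x + v x) x = gradient u x + gradient v x"
  by (rule gradient_eqI)
    (use assms in \<open>auto simp: inner_add_left intro!: has_derivative_add has_derivative_gradient\<close>)

lemma gradient_mult:
  assumes "u differentiable (at x)" "v differentiable (at x)"
  shows "gradient (\<lambda>x. u x * v x) x = u x *\<^sub>R gradient v x + v x *\<^sub>R gradient u x"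
  by (rule gradient_eqI)
    (use has_derivative_mult[OF assms[THEN has_derivative_gradient]] in
      \<open>simp add: inner_add_left algebra_simps\<close>)

lemma gradient_compose:
  assumes "(f has_real_derivative f') (at (q x))" "q differentiable (at x)"
  shows "gradient (\<lambda>x. f (q x)) x = f' *\<^sub>R gradient q x"
proof (rule gradient_eqI)
  have "(f \<circ> q has_derivative (\<lambda>h. f' * h) \<circ> (\<lambda>h. gradient q x \<bullet> h)) (at x)"
    using assms has_derivative_gradient[OF assms(2)]
    by (intro diff_chain_at) (auto simp: has_field_derivative_def)
  then show "((\<lambda>x. f (q x)) has_derivative (\<lambda>h. (f' *\<^sub>R gradient q x) \<bullet> h)) (at x)"
    unfolding o_def inner_scaleR_left .
qed

lemma differentiable_compose_real:
  assumes "(f has_real_derivative f') (at (q x))" "q differentiable (at x)"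
  shows "(\<lambda>x. f (q x)) differentiable (at x)"
  using differentiable_chain_at[OF assms(2), of f] assms(1)
  by (auto simp: o_def dest: has_field_derivative_imp_has_derivative differentiableI)

lemma C_k_const: "C_k m (\<lambda>_. c)"
proof (induction m arbitrary: c)
  case (Suc m)
  have "partial_deriv i (\<lambda>_. c) = (\<lambda>_. 0)" for i :: 'a
    by (auto simp: partial_derivI[where v = 0] fun_eq_iff)
  then show ?case using Suc by simp
qed auto

lemma C_k_nth: "C_k m (\<lambda>x. x $ j)"
proof (cases m)
  case (Suc n)
  have D: "((\<lambda>x. x $ j) has_derivative (\<lambda>h. axis j 1 \<bullet> h)) (at x)" for x :: "real ^ 'a"
    by (simp add: inner_axis' bounded_linear_vec_nth bounded_linear_imp_has_derivative)
  have "partial_deriv i (\<lambda>x. x $ j) = (\<lambda>_. axis j 1 $ i)" for i :: 'a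
    by (auto simp: partial_derivI[OF D] fun_eq_iff)
  then show ?thesis
    using Suc D by (auto simp: C_k_const differentiable_def)
qed (auto intro!: continuous_intros)

lemma C_k_add: "C_k m u \<Longrightarrow> C_k m v \<Longrightarrow> C_k m (\<lambda>x. u x + v x)"
proof (induction m arbitrary: u v)
  case (Suc m)
  have "partial_deriv i (\<lambda>x. u x + v x) = (\<lambda>x. partial_deriv i u x + partial_deriv i v x)" for i
    using Suc.prems by (simp add: gradient_add fun_eq_iff flip: gradient_nth)
  then show ?case using Suc by (auto intro: differentiable_add)
qed (auto intro: continuous_on_add)

lemma C_k_mult: "C_k m u \<Longrightarrow> C_k m v \<Longrightarrow> C_k m (\<lambda>x. u x * v x)"
proof (induction m arbitrary: u v)
  case (Suc m)
  have "partial_deriv i (\<lambda>x. u x * v x) = (\<lambda>x. u x * partial_deriv i v x + v x * partial_deriv i u x)" for i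
    using Suc.prems by (simp add: gradient_mult fun_eq_iff flip: gradient_nth)
  moreover have "C_k m u" "C_k m v"
    using Suc.prems by (auto intro: C_k_SucD)
  ultimately show ?case using Suc by (auto intro!: differentiable_mult C_k_add Suc.IH)
qed (auto intro: continuous_on_mult)

lemma C_k_sum: "(\<And>i. i \<in> A \<Longrightarrow> C_k m (f i)) \<Longrightarrow> C_k m (\<lambda>x. \<Sum>i\<in>A. f i x)"
  by (induction A rule: infinite_finite_induct) (auto intro: C_k_add C_k_const)

text \<open>
  The induction on the order of differentiability runs over all members of the sequence \<open>F\<close> of
  successive derivatives at once. They are only required to be derivatives at points in the range
  of \<open>q\<close>, so that \<open>F 0\<close> may be a real power when \<open>q\<close> is positive.
\<close>

lemma C_k_compose:
  assumes F: "\<And>j x. (F j has_real_derivative F (Suc j) (q x)) (at (q x))"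
    and q: "\<And>m. C_k m q"
  shows "C_k m (\<lambda>x. F j (q x))"
proof (induction m arbitrary: j)
  case 0
  have "continuous_on UNIV q" using q[of 0] by simp
  then have "continuous (at x) (\<lambda>x. F j (q x))" for x
    using continuous_at_compose[of x q "F j"] DERIV_isCont[OF F]
    by (simp add: o_def continuous_on_eq_continuous_at)
  then show ?case by (simp add: continuous_on_eq_continuous_at)
next
  case (Suc m)
  have dq: "q differentiable (at x)" for x using q[of 1] by simp
  have "partial_deriv i (\<lambda>x. F j (q x)) = (\<lambda>x. F (Suc j) (q x) * partial_deriv i q x)" for i
    by (simp add: gradient_compose[OF F dq] fun_eq_iff flip: gradient_nth)
  moreover have "C_k m (partial_deriv i q)" for i using q[of "Suc m"] by simp
  ultimately show ?case
    using Suc by (auto intro!: C_k_mult differentiable_compose_real[OF F dq])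
qed

section \<open>A smooth bump function\<close>

text \<open>
  These are the functions \<open>P (1/s) exp (- 1/s)\<close>, extended by \<open>0\<close> to \<open>s \<le> 0\<close>. The class contains
  all derivatives of its member \<open>P = 1\<close>.
\<close>

definition exp_recip :: "real poly \<Rightarrow> real \<Rightarrow> real" where
  "exp_recip P s = (if s > 0 then poly P (inverse s) * exp (- inverse s) else 0)"

lemma poly_times_exp_uminus_tendsto_0: "((\<lambda>x::real. poly P x * exp (- x)) \<longlongrightarrow> 0) at_top"
proof -
  have "((\<lambda>x::real. \<Sum>i\<le>degree P. coeff P i * (x ^ i / exp x)) \<longlongrightarrow> (\<Sum>i\<le>degree P. coeff P i * 0)) at_top"
    by (intro tendsto_intros tendsto_power_div_exp_0)
  then show ?thesis
    by (simp add: poly_altdef exp_minus sum_distrib_right divide_inverse mult.assoc)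
qed

text \<open>
  Away from \<open>0\<close> this is the chain rule, \<open>[:0, 0, 1:]\<close> being the factor \<open>1/s\<^sup>2\<close>. At \<open>0\<close>
  the difference quotient from the right is a polynomial in \<open>1/s\<close> times \<open>exp (- 1/s)\<close>, which tends to \<open>0\<close>.
\<close>

lemma has_real_derivative_exp_recip:
  "(exp_recip P has_real_derivative exp_recip ([:0, 0, 1:] * (P - pderiv P)) s) (at s)"
proof -
  consider "s < 0" | "s = 0" | "s > 0" by linarith
  then show ?thesis
  proof cases
    case 1
    have "((\<lambda>_. 0) has_real_derivative 0) (at s)" by simp
    then have "(exp_recip P has_real_derivative 0) (at s)"
      by (rule DERIV_cong_ev[THEN iffD1, rotated -1])
        (use 1 eventually_nhds_in_open[of "{..<0}" s] in
          \<open>auto simp: exp_recip_def elim!: eventually_mono\<close>)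
    with 1 show ?thesis by (simp add: exp_recip_def)
  next
    case 2
    have "((\<lambda>h. exp_recip P h / h) \<longlongrightarrow> 0) (at_left 0)"
      by (rule Lim_transform_eventually[where f = "\<lambda>_. 0"])
        (auto simp: exp_recip_def eventually_at_filter)
    moreover have "((\<lambda>h. exp_recip P h / h) \<longlongrightarrow> 0) (at_right 0)"
    proof (rule Lim_transform_eventually)
      show "((\<lambda>h. poly ([:0, 1:] * P) (inverse h) * exp (- inverse h)) \<longlongrightarrow> 0) (at_right (0::real))"
        by (rule filterlim_compose[OF poly_times_exp_uminus_tendsto_0 filterlim_inverse_at_top_right])
      show "\<forall>\<^sub>F h in at_right 0. poly ([:0, 1:] * P) (inverse h) * exp (- inverse h) = exp_recip P h / h"
        by (auto simp: exp_recip_def eventually_at_filter divide_inverse)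
    qed
    ultimately show ?thesis
      using 2 by (simp add: has_field_derivative_iff filterlim_split_at exp_recip_def)
  next
    case 3
    have "((\<lambda>s. poly P (inverse s) * exp (- inverse s)) has_real_derivative
        exp_recip ([:0, 0, 1:] * (P - pderiv P)) s) (at s)"
      using 3 by (auto intro!: derivative_eq_intros DERIV_chain2[OF poly_DERIV]
          simp: exp_recip_def power2_eq_square algebra_simps)
    then show ?thesis
      by (rule DERIV_cong_ev[THEN iffD1, rotated -1])
        (use 3 eventually_nhds_in_open[of "{0<..}" s] in
          \<open>auto simp: exp_recip_def elim!: eventually_mono\<close>)
  qed
qed

section \<open>Test functions\<close>

lemma test_functionI:
  fixes u :: "real ^ 'n::finite \<Rightarrow> real"
  assumes "\<And>m. C_k m u" and "\<And>x. R < norm x \<Longrightarrow> u x = 0"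
  shows "test_function u"
proof -
  have "{x. u x \<noteq> 0} \<subseteq> cball 0 R"
    using assms(2) by (force simp: not_less[symmetric])
  then have "bounded {x. u x \<noteq> 0}"
    using bounded_cball bounded_subset by blast
  then show ?thesis
    using assms(1) by (simp add: test_function_def compact_closure)
qed

lemma test_function_differentiable: "test_function u \<Longrightarrow> u differentiable (at x)"
  using C_k_differentiable unfolding test_function_def by blast

lemma test_function_continuous: "test_function u \<Longrightarrow> continuous_on UNIV u"
  unfolding test_function_def using C_k.simps(1) by blast

lemma gradient_continuous:
  assumes "test_function u"
  shows "continuous_on UNIV (gradient u)"
proof -
  have "C_k (Suc 0) u" using assms by (simp only: test_function_def)
  then show ?thesis
    unfolding gradient_def by (intro continuous_on_vec_lambda) auto
qed

lemma test_function_support: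
  fixes u :: "real ^ 'n::finite \<Rightarrow> real"
  assumes "test_function u"
  shows "\<exists>R. \<forall>x. R < norm x \<longrightarrow> u x = 0 \<and> gradient u x = 0"
proof -
  have "bounded {x. u x \<noteq> 0}"
    using assms bounded_subset[OF compact_imp_bounded closure_subset] by (simp add: test_function_def)
  then obtain R where R: "\<And>x. u x \<noteq> 0 \<Longrightarrow> norm x \<le> R"
    unfolding bounded_iff by blast
  have "gradient u x = 0" if "R < norm x" for x
  proof (rule gradient_eqI)
    have "open {x::real^'n. R < norm x}"
      by (intro open_Collect_less continuous_intros)
    moreover have "u y = 0" if "y \<in> {x. R < norm x}" for y
      using R[of y] that by force
    moreover have "((\<lambda>_. 0) has_derivative (\<lambda>h. 0 \<bullet> h)) (at x)"
      by simp
    ultimately show "(u has_derivative (\<lambda>h. 0 \<bullet> h)) (at x)"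
      using \<open>R < norm x\<close>
      by (auto intro: has_derivative_transform_within_open[where f = "\<lambda>_. 0" and s = "{x. R < norm x}"])
  qed
  moreover have "u x = 0" if "R < norm x" for x
    using R[of x] that by force
  ultimately show ?thesis by blast
qed

text \<open>
  This form serves to dominate integrands by the indicator of a ball.
\<close>

lemma test_function_gradient_bounded:
  fixes u :: "real ^ 'n::finite \<Rightarrow> real"
  assumes "test_function u"
  shows "\<exists>R B. 0 < R \<and> 0 < B \<and> (\<forall>x. norm (gradient u x) \<le> B * indicat_real (cball 0 R) x)"
proof -
  obtain R where R: "\<forall>x. R < norm x \<longrightarrow> u x = 0 \<and> gradient u x = 0"
    using test_function_support[OF assms] by (rule exE)
  have "compact (gradient u ` cball 0 (max 1 R))"
    using gradient_continuous[OF assms]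
    by (intro compact_continuous_image) (auto intro: continuous_on_subset)
  then obtain B where B: "0 < B" "\<And>x. x \<in> cball 0 (max 1 R) \<Longrightarrow> norm (gradient u x) \<le> B"
    using compact_imp_bounded[of "gradient u ` cball 0 (max 1 R)"] unfolding bounded_pos by blast
  have "norm (gradient u x) \<le> B * indicat_real (cball 0 (max 1 R)) x" for x
    using B R by (cases "x \<in> cball 0 (max 1 R)") auto
  then show ?thesis using B(1) by (intro exI[of _ "max 1 R"] exI[of _ B]) auto
qed

definition bump :: "real \<Rightarrow> real ^ 'n::finite \<Rightarrow> real" where
  "bump R x = exp_recip 1 (R - x \<bullet> x)"

lemma C_k_sum_squares: "C_k m (\<lambda>x. \<Sum>i\<in>S. x $ i * x $ i)"
  by (intro C_k_sum C_k_mult C_k_nth)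

lemma C_k_bump: "C_k m (bump R :: real ^ 'n::finite \<Rightarrow> real)"
proof -
  define P :: "nat \<Rightarrow> real poly" where "P j = ((\<lambda>Q. [:0, 0, 1:] * (Q - pderiv Q)) ^^ j) 1" for j
  have "C_k m (\<lambda>x::real^'n. exp_recip (P 0) (R + (-1) * (\<Sum>i\<in>UNIV. x $ i * x $ i)))"
  proof (rule C_k_compose[where F = "\<lambda>j. exp_recip (P j)"])
    show "(exp_recip (P j) has_real_derivative
        exp_recip (P (Suc j)) (R + - 1 * (\<Sum>i\<in>UNIV. x $ i * x $ i)))
        (at (R + - 1 * (\<Sum>i\<in>UNIV. x $ i * x $ i)))" for j and x :: "real^'n"
      using has_real_derivative_exp_recip[of "P j"] by (simp only: P_def funpow.simps o_apply)
  qed (intro C_k_add C_k_mult C_k_const C_k_sum_squares)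
  then show ?thesis
    by (simp add: bump_def[abs_def] P_def inner_vec_def)
qed

lemma bump_bounds: "0 \<le> bump R x" "bump R x \<le> 1"
  by (auto simp: bump_def exp_recip_def)

lemma bump_ge: "x \<bullet> x \<le> R - 1 \<Longrightarrow> exp (- 1) \<le> bump R x"
  by (auto simp: bump_def exp_recip_def field_simps)

lemma bump_eq_0: "R \<le> x \<bullet> x \<Longrightarrow> bump R x = 0"
  by (auto simp: bump_def exp_recip_def)

lemma bump_eq_0_norm: 
  assumes "1 \<le> R" "R < norm x" shows "bump R x = 0"
proof -
  have "R * 1 \<le> norm x * norm x" using assms by (intro mult_mono) auto
  then show ?thesis by (intro bump_eq_0) (simp add: dot_square_norm power2_eq_square)
qed

lemma test_function_bump: "1 \<le> R \<Longrightarrow> test_function (bump R)"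
  by (rule test_functionI[where R = R]) (auto simp: C_k_bump bump_eq_0_norm)

section \<open>Dilations of the weighted variable\<close>

definition proj :: "'n::finite set \<Rightarrow> real ^ 'n \<Rightarrow> real ^ 'n" where
  "proj S x = (\<chi> i. if i \<in> S then x $ i else 0)"

definition dilate :: "'n::finite set \<Rightarrow> real \<Rightarrow> real ^ 'n \<Rightarrow> real ^ 'n" where
  "dilate S t x = (\<chi> i. if i \<in> S then t * x $ i else x $ i)"

lemma norm_proj: "norm (proj S x) = ynorm S x"
proof -
  have "(\<Sum>i\<in>UNIV. (norm (proj S x $ i))\<^sup>2) = (\<Sum>i\<in>S. (x $ i)\<^sup>2)"
    by (rule sum.mono_neutral_cong_right) (auto simp: proj_def)
  then show ?thesis by (simp add: norm_vec_def ynorm_def L2_set_def)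
qed

lemma ynorm_nonneg: "0 \<le> ynorm S x"
  by (simp flip: norm_proj)

lemma ynorm_le_norm: "ynorm S x \<le> norm x"
  unfolding ynorm_def norm_vec_def L2_set_def
  by (intro real_sqrt_le_mono) (auto intro!: sum_mono2)

lemma ynorm_sq: "(ynorm S x)\<^sup>2 = (\<Sum>i\<in>S. x $ i * x $ i)"
  by (simp add: ynorm_def L2_set_def sum_nonneg power2_eq_square)

lemma continuous_on_ynorm: "continuous_on A (ynorm S)"
  unfolding ynorm_def[abs_def] L2_set_def by (intro continuous_intros)

lemma measurable_ynorm [measurable]: "ynorm S \<in> borel_measurable borel"
  using continuous_on_ynorm by (rule borel_measurable_continuous_onI)

lemma ynorm_dilate: "0 \<le> t \<Longrightarrow> ynorm S (dilate S t x) = t * ynorm S x"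
  by (simp add: ynorm_def dilate_def L2_set_def power_mult_distrib flip: sum_distrib_left)
    (simp add: real_sqrt_mult)

lemma dilate_eq_add_proj: "dilate S t x = x + (t - 1) *\<^sub>R proj S x"
  by (simp add: dilate_def proj_def vec_eq_iff algebra_simps)

lemma bounded_linear_proj: "bounded_linear (proj S)"
  by (rule bounded_linear_intro[where K = 1])
    (auto simp: norm_proj ynorm_le_norm, auto simp: proj_def vec_eq_iff)

lemma continuous_on_dilate: "continuous_on A (dilate S t)"
  unfolding dilate_eq_add_proj[abs_def]
  by (intro continuous_intros linear_continuous_on bounded_linear_proj)

text \<open>
  A dilation is the diagonal linear map with \<open>card S\<close> entries \<open>t\<close> and all others \<open>1\<close>.
\<close>

lemma nn_integral_dilate:
  fixes f :: "real ^ 'n::finite \<Rightarrow> ennreal"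
  assumes [measurable]: "f \<in> borel_measurable borel" and t: "0 < t"
  shows "ennreal (t ^ card S) * (\<integral>\<^sup>+x. f (dilate S t x) \<partial>lborel) = (\<integral>\<^sup>+x. f x \<partial>lborel)"
proof -
  define c :: "real ^ 'n \<Rightarrow> real" where "c j = (if \<exists>i\<in>S. j = axis i 1 then t else 1)" for j
  have c_axis: "c (axis i 1) = (if i \<in> S then t else 1)" for i
    by (auto simp: c_def axis_eq_axis)
  have Basis: "Basis = (\<lambda>i. axis i 1 :: real ^ 'n) ` UNIV"
    by (auto simp: Basis_vec_def)
  have inj: "inj (\<lambda>i. axis i 1 :: real ^ 'n)"
    by (auto simp: inj_on_def axis_eq_axis)
  have T: "0 + (\<Sum>j\<in>Basis. (c j * (x \<bullet> j)) *\<^sub>R j) = dilate S t x" for x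
  proof -
    have "(\<Sum>j\<in>Basis. (c j * (x \<bullet> j)) *\<^sub>R j) = (\<Sum>i\<in>UNIV. (dilate S t x $ i) *\<^sub>R axis i 1)"
      unfolding Basis
      by (subst sum.reindex[OF inj]) (auto simp: c_axis inner_axis dilate_def intro!: sum.cong)
    then show ?thesis using basis_expansion[of "dilate S t x"] by (simp add: scalar_mult_eq_scaleR)
  qed
  have P: "(\<Prod>j\<in>Basis. \<bar>c j\<bar>) = t ^ card S"
    unfolding Basis by (subst prod.reindex[OF inj]) (use t in \<open>simp add: c_axis if_distrib prod.If_cases\<close>)
  have [measurable]: "dilate S t \<in> borel_measurable borel"
    by (intro borel_measurable_continuous_onI) (rule continuous_on_dilate)
  have "lborel = density (distr lborel borel (dilate S t)) (\<lambda>_. ennreal (t ^ card S))"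
    using lborel_affine_euclidean[of c 0] t unfolding T P by (auto simp: c_def split: if_splits)
  then have "(\<integral>\<^sup>+x. f x \<partial>lborel) = (\<integral>\<^sup>+x. f x \<partial>density (distr lborel borel (dilate S t)) (\<lambda>_. ennreal (t ^ card S)))"
    by (rule arg_cong)
  also have "\<dots> = ennreal (t ^ card S) * (\<integral>\<^sup>+x. f (dilate S t x) \<partial>lborel)"
    by (simp add: nn_integral_density nn_integral_distr nn_integral_cmult)
  finally show ?thesis ..
qed

section \<open>The weighted Hardy inequality\<close>

text \<open>
  The graph of \<open>f \<mapsto> f powr p\<close> lies above its tangent at \<open>m\<close>; here this is Young's inequality for
  the product of \<open>f\<close> and \<open>m powr (p - 1)\<close>.
\<close>

lemma powr_tangent_le:
  fixes p f m :: real
  assumes "1 < p" "0 \<le> f" "0 \<le> m"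
  shows "p * m powr (p - 1) * f \<le> f powr p + (p - 1) * m powr p"
proof -
  have "f * m powr (p - 1) \<le> f powr p / p + (m powr (p - 1)) powr (p / (p - 1)) / (p / (p - 1))"
    using assms by (intro Youngs_inequality) (auto simp: field_simps)
  then have "p * (f * m powr (p - 1)) \<le> p * (f powr p / p + m powr p * (p - 1) / p)"
    using assms by (intro mult_left_mono) (simp_all add: powr_powr)
  also have "\<dots> = f powr p + (p - 1) * m powr p"
    using assms by (simp add: distrib_left)
  finally show ?thesis by (simp add: ac_simps)
qed

text \<open>
  Jensen's inequality for the probability density \<open>w\<close>. The tangent is taken at the lower bound
  \<open>m\<close> of the mean, not at the mean itself, so the mean may be infinite.
\<close>

lemma powr_le_weighted_mean_powr:
  fixes f w :: "'a \<Rightarrow> real"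
  assumes p: "1 < p" and m: "0 \<le> m"
    and [measurable]: "f \<in> borel_measurable M" "w \<in> borel_measurable M"
    and f: "\<And>x. 0 \<le> f x" and w: "\<And>x. 0 \<le> w x"
    and w1: "(\<integral>\<^sup>+x. w x \<partial>M) = 1"
    and mean: "ennreal m \<le> (\<integral>\<^sup>+x. f x * w x \<partial>M)"
  shows "ennreal (m powr p) \<le> (\<integral>\<^sup>+x. f x powr p * w x \<partial>M)"
proof -
  have "ennreal (p * m powr p) = ennreal (p * m powr (p - 1)) * ennreal m"
    using p m by (cases "m = 0") (auto simp: powr_diff simp flip: ennreal_mult)
  also have "\<dots> \<le> ennreal (p * m powr (p - 1)) * (\<integral>\<^sup>+x. f x * w x \<partial>M)"
    by (intro mult_left_mono mean) simp
  also have "\<dots> = (\<integral>\<^sup>+x. ennreal (p * m powr (p - 1) * f x * w x) \<partial>M)"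
    using p f w by (simp add: mult.assoc ennreal_mult nn_integral_cmult)
  also have "\<dots> \<le> (\<integral>\<^sup>+x. ennreal (f x powr p * w x) + ennreal ((p - 1) * m powr p) * ennreal (w x) \<partial>M)"
  proof (intro nn_integral_mono)
    fix x
    have "p * m powr (p - 1) * f x * w x \<le> (f x powr p + (p - 1) * m powr p) * w x"
      using powr_tangent_le[OF p f m] w by (rule mult_right_mono)
    then show "ennreal (p * m powr (p - 1) * f x * w x)
        \<le> ennreal (f x powr p * w x) + ennreal ((p - 1) * m powr p) * ennreal (w x)"
      using p w f by (simp add: distrib_right flip: ennreal_plus ennreal_mult)
  qed
  also have "\<dots> = (\<integral>\<^sup>+x. f x powr p * w x \<partial>M) + ennreal ((p - 1) * m powr p)"
    by (simp add: nn_integral_add nn_integral_cmult w1)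
  finally have le: "ennreal (p * m powr p) \<le> (\<integral>\<^sup>+x. f x powr p * w x \<partial>M) + ennreal ((p - 1) * m powr p)" .
  have "ennreal (p * m powr p) = ennreal (m powr p + (p - 1) * m powr p)"
    by (simp add: left_diff_distrib)
  also have "\<dots> = ennreal (m powr p) + ennreal ((p - 1) * m powr p)"
    using p by (intro ennreal_plus) auto
  finally have "ennreal (m powr p) + ennreal ((p - 1) * m powr p)
      \<le> (\<integral>\<^sup>+x. f x powr p * w x \<partial>M) + ennreal ((p - 1) * m powr p)"
    using le by simp
  then show ?thesis
    by (simp only: add.commute[of _ "ennreal ((p - 1) * m powr p)"] ennreal_add_left_cancel_le) simp
qed

text \<open>
  The curve \<open>s \<mapsto> D\<^sub>t x\<close>, \<open>t = exp s\<close>, has velocity of norm \<open>\<bar>t y\<bar>\<close>, which is the \<open>y\<close>-norm of the current point.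
  As \<open>y\<close> is nonzero, the curve leaves the support of \<open>u\<close>, and the fundamental theorem of
  calculus applies up to a time \<open>T\<close> at which \<open>u\<close> has vanished.
\<close>

lemma abs_le_integral_along_ray:
  fixes u :: "real ^ 'n::finite \<Rightarrow> real"
  assumes u: "test_function u" and x: "ynorm S x \<noteq> 0"
  defines "G \<equiv> \<lambda>x. norm (gradient u x) * ynorm S x"
  shows "ennreal \<bar>u x\<bar> \<le> (\<integral>\<^sup>+s. G (dilate S (exp s) x) * indicator {0..} s \<partial>lborel)"
proof -
  obtain R where R: "\<forall>x. R < norm x \<longrightarrow> u x = 0 \<and> gradient u x = 0"
    using test_function_support[OF u] by (rule exE)
  have y: "0 < ynorm S x" using x ynorm_nonneg[of S x] by linarith
  \<comment> \<open>At \<open>s = T\<close> the \<open>y\<close>-part of the point has norm at least \<open>\<bar>R\<bar> + 1\<close>, which puts it outside the support.\<close>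
  define T where "T = max 0 (ln ((\<bar>R\<bar> + 1) / ynorm S x))"
  have "(\<bar>R\<bar> + 1) / ynorm S x = exp (ln ((\<bar>R\<bar> + 1) / ynorm S x))"
    using y by simp
  also have "\<dots> \<le> exp T" by (simp add: T_def)
  finally have "\<bar>R\<bar> + 1 \<le> ynorm S (dilate S (exp T) x)"
    using y by (simp add: ynorm_dilate field_simps)
  then have "R < norm (dilate S (exp T) x)"
    using ynorm_le_norm[of S "dilate S (exp T) x"] by linarith
  then have uT: "u (dilate S (exp T) x) = 0" using R by blast
  define g where "g s = gradient u (dilate S (exp s) x) \<bullet> (exp s *\<^sub>R proj S x)" for s
  have D: "((\<lambda>s. u (dilate S (exp s) x)) has_vector_derivative g s) (at s within A)" for s A
  proof -
    have "((\<lambda>s. dilate S (exp s) x) has_derivative (\<lambda>h. h *\<^sub>R (exp s *\<^sub>R proj S x))) (at s)"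
      unfolding dilate_eq_add_proj by (auto intro!: derivative_eq_intros simp: algebra_simps)
    then have "((\<lambda>s. u (dilate S (exp s) x)) has_derivative
        (\<lambda>h. gradient u (dilate S (exp s) x) \<bullet> (h *\<^sub>R (exp s *\<^sub>R proj S x)))) (at s)"
      using has_derivative_gradient[OF test_function_differentiable[OF u]]
      by (rule has_derivative_compose)
    then show ?thesis
      by (auto simp: has_vector_derivative_def g_def mult.assoc intro: has_derivative_at_withinI)
  qed
  have cont_ray: "continuous_on UNIV (\<lambda>s. dilate S (exp s) x)"
    unfolding dilate_eq_add_proj by (intro continuous_intros)
  have cont: "continuous_on A g" for A
    unfolding g_def
    by (intro continuous_intros continuous_on_subset[OF continuous_on_compose2[OF gradient_continuous[OF u] cont_ray]]) auto
  have int: "has_bochner_integral lborel (\<lambda>s. indicator {0..T} s *\<^sub>R g s) (u (dilate S (exp T) x) - u (dilate S (exp 0) x))"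
    by (rule has_bochner_integral_FTC_Icc[OF _ D cont]) (simp add: T_def)
  then have integrable: "integrable lborel (\<lambda>s. indicator {0..T} s *\<^sub>R g s)"
    unfolding has_bochner_integral_iff by blast
  have "dilate S (exp 0) x = x" by (simp add: dilate_eq_add_proj)
  then have "(\<integral>s. indicator {0..T} s *\<^sub>R g s \<partial>lborel) = - u x"
    using has_bochner_integral_integral_eq[OF int] unfolding uT by simp
  then have "ennreal \<bar>u x\<bar> = norm (\<integral>s. indicator {0..T} s *\<^sub>R g s \<partial>lborel)"
    by (simp only: norm_minus_cancel real_norm_def abs_minus_cancel)
  also have "\<dots> \<le> (\<integral>\<^sup>+s. norm (indicator {0..T} s *\<^sub>R g s) \<partial>lborel)"
    by (rule integral_norm_bound_ennreal[OF integrable])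
  also have "\<dots> \<le> (\<integral>\<^sup>+s. G (dilate S (exp s) x) * indicator {0..} s \<partial>lborel)"
  proof (intro nn_integral_mono ennreal_leI)
    fix s
    have "\<bar>g s\<bar> \<le> norm (gradient u (dilate S (exp s) x)) * norm (exp s *\<^sub>R proj S x)"
      unfolding g_def by (rule Cauchy_Schwarz_ineq2)
    also have "\<dots> = G (dilate S (exp s) x)"
      by (simp add: G_def ynorm_dilate norm_proj)
    finally have "\<bar>g s\<bar> \<le> G (dilate S (exp s) x)" .
    moreover have "0 \<le> G (dilate S (exp s) x)"
      unfolding G_def by (intro mult_nonneg_nonneg ynorm_nonneg norm_ge_zero)
    ultimately show "norm (indicator {0..T} s *\<^sub>R g s) \<le> G (dilate S (exp s) x) * indicator {0..} s"
      by (cases "s \<in> {0..T}"; cases "0 \<le> s") simp_all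
  qed
  finally show ?thesis .
qed

lemma nn_integral_exponential_density:
  assumes "0 < b"
  shows "(\<integral>\<^sup>+s. ennreal (b * exp (- b * s) * indicator {0..} s) \<partial>lborel) = 1"
proof -
  have "((\<lambda>s. - exp (- b * s)) \<longlongrightarrow> - 0) at_top"
    using assms
    by (intro tendsto_minus filterlim_compose[OF exp_at_bot]
        filterlim_tendsto_neg_mult_at_bot[OF tendsto_const] filterlim_ident) auto
  then have "(\<integral>\<^sup>+s. ennreal (b * exp (- b * s)) * indicator {0..} s \<partial>lborel) = ennreal (- 0 - - exp (- b * 0))"
    using assms
    by (intro nn_integral_FTC_atLeast) (auto intro!: derivative_eq_intros)
  then show ?thesis
    using assms by (simp add: ennreal_mult'' ennreal_indicator)
qed

text \<open>
  Jensen's inequality along the ray through \<open>x\<close> bounds \<open>\<bar>u x\<bar> powr p * \<bar>y\<bar> powr \<alpha>\<close> by the integral over \<open>s\<close> of a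
  density \<open>w s\<close> times \<open>exp s ^ k * F (D\<^sub>t x)\<close>, \<open>F x = G x powr p * \<bar>y\<bar> powr \<alpha>\<close>, up to the constant; the power of
  \<open>exp s\<close> is \<open>k\<close> because \<open>b p = \<alpha> + k\<close>. By Tonelli the integral over \<open>x\<close> can be done first, and \<open>exp s ^ k\<close> is just
  the factor by which the dilation changes the measure.
\<close>

lemma weighted_hardy_inequality:
  fixes u :: "real ^ 'n::finite \<Rightarrow> real" and S :: "'n set" and p \<alpha> :: real
  assumes u: "test_function u" and p: "1 < p" and pos: "0 < \<alpha> + card S"
  defines "b \<equiv> (\<alpha> + card S) / p"
  shows "weighted_integral S p \<alpha> u
    \<le> ennreal ((1 / b) powr p) * weighted_integral S p (\<alpha> + p) (gradient u)"
proof -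
  define k where "k = card S"
  have b: "0 < b" using p pos by (simp add: b_def)
  have bp: "b * p = \<alpha> + k" using p by (simp add: b_def k_def)
  define G where "G x = norm (gradient u x) * ynorm S x" for x
  define F where "F x = G x powr p * ynorm S x powr \<alpha>" for x
  define w where "w s = b * exp (- b * s) * indicator {0..} s" for s :: real
  have G0: "0 \<le> G x" for x by (simp add: G_def ynorm_nonneg)
  have w0: "0 \<le> w s" for s using b by (simp add: w_def)
  have [measurable]: "gradient u \<in> borel_measurable borel"
    using gradient_continuous[OF u] by (rule borel_measurable_continuous_onI)
  have G_meas [measurable]: "G \<in> borel_measurable borel"
    unfolding G_def by measurable
  have F_meas [measurable]: "F \<in> borel_measurable borel"
    unfolding F_def by measurable
  have w_meas [measurable]: "w \<in> borel_measurable borel"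
    unfolding w_def by measurable
  have ray [measurable]: "(\<lambda>s. dilate S (exp s) x) \<in> borel_measurable borel" for x :: "real ^ 'n"
    by (intro borel_measurable_continuous_onI) (unfold dilate_eq_add_proj, intro continuous_intros)
  have meas: "(\<lambda>(x, s). ennreal (w s * exp s ^ k * F (dilate S (exp s) x)))
      \<in> borel_measurable (lborel \<Otimes>\<^sub>M lborel)"
  proof -
    have "(\<lambda>(x, s). dilate S (exp s) x) \<in> borel_measurable (borel :: ((real ^ 'n) \<times> real) measure)"
      unfolding case_prod_beta
      by (intro borel_measurable_continuous_onI)
        (unfold dilate_eq_add_proj, intro continuous_intros bounded_linear.continuous_on[OF bounded_linear_proj])
    then have [measurable]: "(\<lambda>z. dilate S (exp (snd z)) (fst z)) \<in> borel_measurable (borel \<Otimes>\<^sub>M borel)"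
      by (simp add: borel_prod case_prod_beta')
    have "(\<lambda>z. ennreal (w (snd z) * exp (snd z) ^ k * F (dilate S (exp (snd z)) (fst z))))
      \<in> borel_measurable (borel \<Otimes>\<^sub>M borel)"
      by measurable
    also have "borel_measurable (borel \<Otimes>\<^sub>M borel) = borel_measurable ((lborel :: (real ^ 'n) measure) \<Otimes>\<^sub>M (lborel :: real measure))"
      by (intro measurable_cong_sets sets_pair_measure_cong) simp_all
    finally show ?thesis by (simp add: case_prod_beta')
  qed
  have pt: "ennreal (norm (u x) powr p * ynorm S x powr \<alpha>)
      \<le> ennreal ((1 / b) powr p) * (\<integral>\<^sup>+s. ennreal (w s * exp s ^ k * F (dilate S (exp s) x)) \<partial>lborel)" for x
  proof (cases "ynorm S x = 0")
    case False
    then have y: "0 < ynorm S x" using ynorm_nonneg[of S x] by linarith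
    let ?f = "\<lambda>s. exp (b * s) * G (dilate S (exp s) x)"
    have "ennreal ((b * \<bar>u x\<bar>) powr p) \<le> (\<integral>\<^sup>+s. ?f s powr p * w s \<partial>lborel)"
    proof (rule powr_le_weighted_mean_powr[OF p])
      have "ennreal (b * \<bar>u x\<bar>) = ennreal b * ennreal \<bar>u x\<bar>"
        using b by (simp add: ennreal_mult)
      also have "\<dots> \<le> ennreal b * (\<integral>\<^sup>+s. G (dilate S (exp s) x) * indicator {0..} s \<partial>lborel)"
        unfolding G_def by (intro mult_left_mono abs_le_integral_along_ray u False) simp
      also have "\<dots> = (\<integral>\<^sup>+s. ennreal b * ennreal (G (dilate S (exp s) x) * indicator {0..} s) \<partial>lborel)"
        by (intro nn_integral_cmult[symmetric]) measurable
      also have "\<dots> = (\<integral>\<^sup>+s. ?f s * w s \<partial>lborel)"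
        using b by (intro nn_integral_cong)
          (auto simp: w_def exp_minus G0 simp flip: ennreal_mult split: split_indicator)
      finally show "ennreal (b * \<bar>u x\<bar>) \<le> (\<integral>\<^sup>+s. ?f s * w s \<partial>lborel)" .
      show "(\<integral>\<^sup>+s. ennreal (w s) \<partial>lborel) = 1"
        unfolding w_def by (rule nn_integral_exponential_density[OF b])
    qed (use b in \<open>auto simp: G0 w0\<close>)
    then have "ennreal (1 / b powr p * ynorm S x powr \<alpha>) * ennreal ((b * \<bar>u x\<bar>) powr p)
        \<le> ennreal (1 / b powr p * ynorm S x powr \<alpha>) * (\<integral>\<^sup>+s. ?f s powr p * w s \<partial>lborel)"
      by (rule mult_left_mono) (rule zero_le)
    also have "\<dots> = ennreal (1 / b powr p) * (\<integral>\<^sup>+s. ynorm S x powr \<alpha> * (?f s powr p * w s) \<partial>lborel)"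
      by (subst ennreal_mult) (simp_all add: ennreal_mult'[of "ynorm S x powr \<alpha>"] mult.assoc nn_integral_cmult)
    also have "(\<lambda>s. ynorm S x powr \<alpha> * (?f s powr p * w s)) = (\<lambda>s. w s * exp s ^ k * F (dilate S (exp s) x))"
    proof
      fix s
      have "p * (b * s) = real k * s + \<alpha> * s"
      proof -
        have "p * (b * s) = (b * p) * s" by simp
        also have "\<dots> = real k * s + \<alpha> * s" by (subst bp) (simp add: algebra_simps)
        finally show ?thesis .
      qed
      then have "exp (b * s) powr p = exp s ^ k * exp s powr \<alpha>"
        by (simp add: powr_def exp_add exp_of_nat_mult)
      then show "ynorm S x powr \<alpha> * (?f s powr p * w s) = w s * exp s ^ k * F (dilate S (exp s) x)"
        by (simp add: F_def ynorm_dilate powr_mult G0 ynorm_nonneg)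
    qed
    finally show ?thesis
      using b by (simp add: powr_mult powr_divide mult.commute[of "ynorm S x powr \<alpha>"] flip: ennreal_mult)
  qed simp
  have "weighted_integral S p \<alpha> u \<le> (\<integral>\<^sup>+x. ennreal ((1 / b) powr p)
      * (\<integral>\<^sup>+s. ennreal (w s * exp s ^ k * F (dilate S (exp s) x)) \<partial>lborel) \<partial>lborel)"
    unfolding weighted_integral_def by (intro nn_integral_mono pt)
  also have "\<dots> = ennreal ((1 / b) powr p)
      * (\<integral>\<^sup>+x. (\<integral>\<^sup>+s. ennreal (w s * exp s ^ k * F (dilate S (exp s) x)) \<partial>lborel) \<partial>lborel)"
    by (intro nn_integral_cmult lborel.borel_measurable_nn_integral meas)
  also have "(\<integral>\<^sup>+x. (\<integral>\<^sup>+s. ennreal (w s * exp s ^ k * F (dilate S (exp s) x)) \<partial>lborel) \<partial>lborel)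
      = (\<integral>\<^sup>+s. (\<integral>\<^sup>+x. ennreal (w s * exp s ^ k * F (dilate S (exp s) x)) \<partial>lborel) \<partial>lborel)"
    by (rule lborel_pair.Fubini'[symmetric]) (rule meas)
  also have "\<dots> = (\<integral>\<^sup>+s. ennreal (w s) * (\<integral>\<^sup>+x. F x \<partial>lborel) \<partial>lborel)"
  proof (intro nn_integral_cong)
    fix s
    have [measurable]: "dilate S (exp s) \<in> borel_measurable borel"
      by (intro borel_measurable_continuous_onI continuous_on_dilate)
    have "(\<integral>\<^sup>+x. ennreal (w s * exp s ^ k * F (dilate S (exp s) x)) \<partial>lborel)
        = ennreal (w s) * (ennreal (exp s ^ k) * (\<integral>\<^sup>+x. F (dilate S (exp s) x) \<partial>lborel))"
      by (simp add: ennreal_mult w0 F_def mult.assoc nn_integral_cmult)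
    also have "ennreal (exp s ^ k) * (\<integral>\<^sup>+x. F (dilate S (exp s) x) \<partial>lborel) = (\<integral>\<^sup>+x. F x \<partial>lborel)"
      unfolding k_def by (rule nn_integral_dilate) auto
    finally show "(\<integral>\<^sup>+x. ennreal (w s * exp s ^ k * F (dilate S (exp s) x)) \<partial>lborel)
        = ennreal (w s) * (\<integral>\<^sup>+x. F x \<partial>lborel)" .
  qed
  also have "\<dots> = (\<integral>\<^sup>+x. F x \<partial>lborel)"
    using nn_integral_exponential_density[OF b] by (subst nn_integral_multc) (simp_all add: w_def)
  also have "\<dots> = weighted_integral S p (\<alpha> + p) (gradient u)"
  proof -
    have "F x = norm (gradient u x) powr p * ynorm S x powr (\<alpha> + p)" for x
      unfolding F_def G_def by (simp add: powr_mult powr_add ynorm_nonneg)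
    then show ?thesis by (simp add: weighted_integral_def)
  qed
  finally show ?thesis .
qed

section \<open>Integrability of powers of the weighted variable\<close>

text \<open>
  Hardy's inequality with a large exponent \<open>q\<close>, applied to a bump function that is bounded
  below on the ball, trades the possibly singular weight with exponent \<open>\<beta>\<close> for one with the positive
  exponent \<open>\<beta> + q\<close>, which is bounded on bounded sets.
\<close>

lemma ynorm_powr_locally_integrable:
  fixes S :: "'n::finite set" and \<beta> :: real
  assumes pos: "0 < \<beta> + card S"
  shows "(\<integral>\<^sup>+(x :: real ^ 'n). ennreal (ynorm S x powr \<beta> * indicat_real (cball 0 r) x) \<partial>lborel) < \<infinity>"
proof -
  \<comment> \<open>Since \<open>\<beta> > - k\<close>, any \<open>q\<close> above \<open>k\<close> and \<open>1\<close> makes \<open>\<beta> + q\<close> positive.\<close>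
  define q :: real where "q = card S + 2"
  have q: "1 < q" "0 < \<beta> + q" using pos by (auto simp: q_def)
  define \<phi> :: "real ^ 'n \<Rightarrow> real" where "\<phi> = bump (r\<^sup>2 + 1)"
  have \<phi>: "test_function \<phi>" unfolding \<phi>_def by (intro test_function_bump) simp
  obtain R B where RB: "0 < R" "0 < B" "\<And>x. norm (gradient \<phi> x) \<le> B * indicat_real (cball 0 R) x"
    using test_function_gradient_bounded[OF \<phi>] by metis
  have "weighted_integral S q (\<beta> + q) (gradient \<phi>)
      \<le> (\<integral>\<^sup>+(x :: real ^ 'n). ennreal (B powr q * R powr (\<beta> + q)) * indicator (cball 0 R) x \<partial>lborel)"
    unfolding weighted_integral_def
  proof (intro nn_integral_mono)
    fix x
    show "ennreal (norm (gradient \<phi> x) powr q * ynorm S x powr (\<beta> + q))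
        \<le> ennreal (B powr q * R powr (\<beta> + q)) * indicator (cball 0 R) x"
    proof (cases "x \<in> cball 0 R")
      case True
      then have "ynorm S x \<le> R" using ynorm_le_norm[of S x] by simp
      moreover have "norm (gradient \<phi> x) \<le> B" using RB(3)[of x] True by simp
      ultimately show ?thesis
        using True q by (auto intro!: ennreal_leI mult_mono powr_mono2 simp: ynorm_nonneg)
    next
      case False
      then have "gradient \<phi> x = 0" using RB(3)[of x] by simp
      then show ?thesis using q by simp
    qed
  qed
  also have "\<dots> < \<infinity>"
    using emeasure_lborel_cball_finite[of "0 :: real^'n" R]
    by (subst nn_integral_cmult_indicator) (auto simp: ennreal_mult_less_top)
  finally have "ennreal ((1 / ((\<beta> + card S) / q)) powr q) * weighted_integral S q (\<beta> + q) (gradient \<phi>) < \<infinity>"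
    by (simp add: ennreal_mult_less_top)
  with weighted_hardy_inequality[OF \<phi> q(1) pos]
  have fin: "weighted_integral S q \<beta> \<phi> < \<infinity>" by (rule le_less_trans)
  have [measurable]: "\<phi> \<in> borel_measurable borel"
    using test_function_continuous[OF \<phi>] by (rule borel_measurable_continuous_onI)
  have "(\<integral>\<^sup>+(x :: real ^ 'n). ennreal (ynorm S x powr \<beta> * indicat_real (cball 0 r) x) \<partial>lborel)
      \<le> (\<integral>\<^sup>+x. ennreal (1 / exp (- 1) powr q) * ennreal (norm (\<phi> x) powr q * ynorm S x powr \<beta>) \<partial>lborel)"
  proof (intro nn_integral_mono)
    fix x
    show "ennreal (ynorm S x powr \<beta> * indicat_real (cball 0 r) x)
        \<le> ennreal (1 / exp (- 1) powr q) * ennreal (norm (\<phi> x) powr q * ynorm S x powr \<beta>)"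
    proof (cases "x \<in> cball 0 r")
      case True
      then have "x \<bullet> x \<le> r\<^sup>2" by (simp add: dot_square_norm power_mono)
      then have "exp (- 1) \<le> \<phi> x" unfolding \<phi>_def by (intro bump_ge) simp
      then have "exp (- 1) powr q \<le> norm (\<phi> x) powr q"
        using q by (intro powr_mono2) auto
      then have "ynorm S x powr \<beta> * exp (- 1) powr q \<le> ynorm S x powr \<beta> * norm (\<phi> x) powr q"
        by (rule mult_left_mono) simp
      then show ?thesis
        using True by (auto intro!: ennreal_leI simp: field_simps simp flip: ennreal_mult)
    qed simp
  qed
  also have "\<dots> = ennreal (1 / exp (- 1) powr q) * weighted_integral S q \<beta> \<phi>"
    unfolding weighted_integral_def
    by (intro nn_integral_cmult) measurable
  also have "\<dots> < \<infinity>" using fin by (simp add: ennreal_mult_less_top)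
  finally show ?thesis .
qed

text \<open>
  At the critical exponent \<open>- k\<close> the measure with this density is invariant under dilations of \<open>y\<close>. Hence
  \<open>\<bar>y\<bar> \<le> 1/2\<close> and \<open>\<bar>y\<bar> \<le> 1\<close> carry the same mass; were it finite, the open shell \<open>U\<close>
  between them would be a null set.
\<close>

lemma ynorm_powr_critical_not_integrable:
  fixes S :: "'n::finite set"
  assumes S: "S \<noteq> {}"
  shows "(\<integral>\<^sup>+x. ennreal (ynorm S x powr (- real (card S)) *
    indicat_real {x. ynorm S x \<le> 1 \<and> ynorm (- S) x \<le> 1} x) \<partial>lborel) = \<infinity>"
proof (rule ccontr)
  define k where "k = card S"
  define f where "f r x = ennreal (ynorm S x powr (- real k) * indicat_real {x. ynorm S x \<le> r \<and> ynorm (- S) x \<le> 1} x)" for r x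
  have [measurable]: "f r \<in> borel_measurable borel" for r
    unfolding f_def by measurable
  have *: "(2::real) ^ k * 2 powr (- real k) = 1"
    by (simp add: powr_minus powr_realpow field_simps)
  define U where "U = {x :: real ^ 'n. 1/2 < ynorm S x \<and> ynorm S x < 1 \<and> ynorm (- S) x < 1}"
  have U_open: "open U"
    unfolding U_def by (intro open_Collect_conj open_Collect_less continuous_on_ynorm continuous_intros)
  then have [measurable]: "U \<in> sets borel" by simp
  assume "\<not> ?thesis"
  then have fin: "(\<integral>\<^sup>+x. f 1 x \<partial>lborel) < \<infinity>"
    by (simp add: f_def[abs_def] k_def top.not_eq_extremum)
  have yn: "ynorm (- S) (dilate S 2 x) = ynorm (- S) x" for x
    unfolding ynorm_def by (rule L2_set_cong) (auto simp: dilate_def)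
  have scale: "ennreal (2 ^ k) * f 1 (dilate S 2 x) = f (1/2) x" for x
    by (auto simp: f_def ynorm_dilate yn powr_mult ynorm_nonneg *
        mult.assoc[symmetric] simp flip: ennreal_mult split: split_indicator)
  have [measurable]: "dilate S 2 \<in> borel_measurable borel"
    by (intro borel_measurable_continuous_onI continuous_on_dilate)
  have "(\<integral>\<^sup>+x. f 1 x \<partial>lborel) = ennreal (2 ^ k) * (\<integral>\<^sup>+x. f 1 (dilate S 2 x) \<partial>lborel)"
    unfolding k_def by (intro nn_integral_dilate[symmetric]) auto
  also have "\<dots> = (\<integral>\<^sup>+x. f (1/2) x \<partial>lborel)"
    by (simp add: nn_integral_cmult[symmetric] scale)
  finally have eq: "(\<integral>\<^sup>+x. f 1 x \<partial>lborel) = (\<integral>\<^sup>+x. f (1/2) x \<partial>lborel)" .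
  \<comment> \<open>On \<open>U\<close> the density is at least \<open>1\<close>, so the shell contributes at least its volume.\<close>
  have "(\<integral>\<^sup>+x. f (1/2) x \<partial>lborel) + emeasure lborel U = (\<integral>\<^sup>+x. f (1/2) x + indicator U x \<partial>lborel)"
    by (simp add: nn_integral_add)
  also have "\<dots> \<le> (\<integral>\<^sup>+x. f 1 x \<partial>lborel)"
  proof (intro nn_integral_mono)
    fix x
    show "f (1/2) x + indicator U x \<le> f 1 x"
    proof (cases "x \<in> U")
      case True
      then have "1 \<le> ynorm S x powr - real k"
        using powr_mono2'[of "- real k" "ynorm S x" 1] by (simp add: U_def)
      with True show ?thesis
        by (auto simp: f_def U_def intro!: ennreal_leI[of 1, simplified])
    qed (auto simp: f_def split: split_indicator)
  qed
  finally have "(\<integral>\<^sup>+x. f 1 x \<partial>lborel) + emeasure lborel U \<le> (\<integral>\<^sup>+x. f 1 x \<partial>lborel) + 0"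
    by (simp add: eq)
  with fin have "emeasure lborel U = 0"
    by (subst (asm) ennreal_add_left_cancel_le) auto
  then have "negligible U"
    by (intro negligible_iff_null_sets[THEN iffD2] null_sets_completionI) auto
  moreover obtain i where "i \<in> S" using S by blast
  then have "axis i (3/4) \<in> U"
  proof -
    have "ynorm S (axis i (3/4)) = 3/4"
      using \<open>i \<in> S\<close> by (simp add: ynorm_def L2_set_def axis_def if_distrib[of "\<lambda>x. x\<^sup>2"] cong: if_cong)
    moreover have "ynorm (- S) (axis i (3/4)) = 0"
      using \<open>i \<in> S\<close> by (auto simp: ynorm_def L2_set_def axis_def intro!: sum.neutral)
    ultimately show ?thesis by (simp add: U_def)
  qed
  ultimately show False using open_not_negligible[OF U_open] by blast
qed

text \<open>
  Either \<open>B\<close> is at most \<open>\<eta> A\<close>, or \<open>A\<close> is at most \<open>B / \<eta>\<close>. The coefficient of \<open>A powr p\<close> can be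
  made arbitrarily close to \<open>1\<close>, at the expense of the other one.
\<close>

lemma powr_add_le:
  fixes A B p \<eta> :: real
  assumes "0 \<le> A" "0 \<le> B" "0 < \<eta>" "0 \<le> p"
  shows "(A + B) powr p \<le> (1 + \<eta>) powr p * A powr p + (1 + 1 / \<eta>) powr p * B powr p"
proof (cases "B \<le> \<eta> * A")
  case True
  then have "(A + B) powr p \<le> ((1 + \<eta>) * A) powr p"
    using assms by (intro powr_mono2) (auto simp: algebra_simps)
  also have "\<dots> = (1 + \<eta>) powr p * A powr p" using assms by (simp add: powr_mult)
  finally show ?thesis by (simp add: add_increasing2)
next
  case False
  then have "(A + B) powr p \<le> ((1 + 1 / \<eta>) * B) powr p"
    using assms by (intro powr_mono2) (auto simp: field_simps)
  also have "\<dots> = (1 + 1 / \<eta>) powr p * B powr p" using assms by (simp add: powr_mult)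
  finally show ?thesis by (simp add: add_increasing)
qed

section \<open>Nearly extremal functions\<close>

text \<open>
  A smooth approximation of \<open>\<bar>y\<bar> powr - b\<close> from below.
\<close>

definition regularised_power :: "'n::finite set \<Rightarrow> real \<Rightarrow> real \<Rightarrow> real ^ 'n \<Rightarrow> real" where
  "regularised_power S b \<epsilon> x = (\<epsilon> + (ynorm S x)\<^sup>2) powr (- b / 2)"

lemma C_k_regularised_power:
  assumes "0 < \<epsilon>"
  shows "C_k m (regularised_power S b \<epsilon>)"
proof -
  define a where "a = - b / 2"
  define F where "F j s = (\<Prod>i<j. a - real i) * s powr (a - real j)" for j and s :: real
  have pos: "0 < \<epsilon> + (\<Sum>i\<in>S. x $ i * x $ i)" for x :: "real ^ 'a"
    using assms by (simp add: add_pos_nonneg sum_nonneg)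
  have "C_k m (\<lambda>x. F 0 (\<epsilon> + (\<Sum>i\<in>S. x $ i * x $ i)))"
  proof (rule C_k_compose[where F = F])
    show "(F j has_real_derivative F (Suc j) (\<epsilon> + (\<Sum>i\<in>S. x $ i * x $ i)))
        (at (\<epsilon> + (\<Sum>i\<in>S. x $ i * x $ i)))" for j and x :: "real ^ 'a"
      unfolding F_def
      by (rule derivative_eq_intros refl pos)+ (use pos[of x] in \<open>simp add: diff_diff_eq add.commute\<close>)
  qed (intro C_k_add C_k_const C_k_sum_squares)
  then show ?thesis
    by (simp add: regularised_power_def[abs_def] F_def a_def ynorm_sq)
qed

lemma regularised_power_pos: "0 < \<epsilon> \<Longrightarrow> 0 < regularised_power S b \<epsilon> x"
  using add_pos_nonneg[of \<epsilon> "(ynorm S x)\<^sup>2"] by (simp add: regularised_power_def)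

lemma regularised_power_le_const:
  assumes "0 < \<epsilon>" "0 \<le> b"
  shows "regularised_power S b \<epsilon> x \<le> \<epsilon> powr (- b / 2)"
  unfolding regularised_power_def using assms by (intro powr_mono2') auto

lemma sq_powr_half: "0 \<le> r \<Longrightarrow> (r\<^sup>2) powr (a / 2) = r powr a" for r a :: real
  by (cases "r = 0") (auto simp: powr_powr simp flip: powr_numeral)

lemma regularised_power_le:
  assumes "0 < \<epsilon>" "0 \<le> b" "ynorm S x \<noteq> 0"
  shows "regularised_power S b \<epsilon> x \<le> ynorm S x powr - b"
proof -
  have "regularised_power S b \<epsilon> x \<le> ((ynorm S x)\<^sup>2) powr (- b / 2)"
    unfolding regularised_power_def using assms by (intro powr_mono2') auto
  then show ?thesis by (simp add: sq_powr_half[OF ynorm_nonneg, where a = "- b", simplified])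
qed

text \<open>
  For \<open>\<epsilon> = 0\<close> this would be an equality, the Euler relation for a function of \<open>y\<close> homogeneous of degree \<open>- b\<close>. In
  general the left-hand side carries an extra factor \<open>\<bar>y\<bar>\<^sup>2 / (\<epsilon> + \<bar>y\<bar>\<^sup>2) \<le> 1\<close>.
\<close>

lemma ynorm_gradient_regularised_power:
  assumes "0 < \<epsilon>" "0 \<le> b"
  shows "ynorm S x * norm (gradient (regularised_power S b \<epsilon>) x) \<le> b * regularised_power S b \<epsilon> x"
proof -
  define q where "q = (\<lambda>x. \<epsilon> + (\<Sum>i\<in>S. x $ i * x $ i))"
  have q: "q x = \<epsilon> + (ynorm S x)\<^sup>2" for x by (simp add: q_def ynorm_sq)
  have qpos: "0 < q x" using assms by (simp add: q add_pos_nonneg)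
  have dq: "(q has_derivative (\<lambda>h. (2 *\<^sub>R proj S x) \<bullet> h)) (at x)"
  proof -
    have "(q has_derivative (\<lambda>h. \<Sum>i\<in>S. x $ i * h $ i + h $ i * x $ i)) (at x)"
      unfolding q_def
      by (auto intro!: derivative_eq_intros bounded_linear_imp_has_derivative bounded_linear_vec_nth)
    also have "(\<lambda>h. \<Sum>i\<in>S. x $ i * h $ i + h $ i * x $ i) = (\<lambda>h. (2 *\<^sub>R proj S x) \<bullet> h)"
    proof
      fix h
      have "(2 *\<^sub>R proj S x) \<bullet> h = (\<Sum>i\<in>UNIV. if i \<in> S then 2 * (x $ i * h $ i) else 0)"
        by (auto simp: inner_vec_def proj_def intro!: sum.cong)
      also have "\<dots> = (\<Sum>i\<in>S. 2 * (x $ i * h $ i))" by (simp add: sum.If_cases)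
      finally show "(\<Sum>i\<in>S. x $ i * h $ i + h $ i * x $ i) = (2 *\<^sub>R proj S x) \<bullet> h"
        by (simp add: algebra_simps)
    qed
    finally show ?thesis .
  qed
  have "((\<lambda>s. s powr (- b / 2)) has_real_derivative (- b / 2 * q x powr (- b / 2 - 1))) (at (q x))"
    using qpos by (auto intro!: derivative_eq_intros)
  then have "gradient (\<lambda>x. q x powr (- b / 2)) x = (- b / 2 * q x powr (- b / 2 - 1)) *\<^sub>R gradient q x"
    by (rule gradient_compose) (use dq in \<open>auto simp: differentiable_def\<close>)
  also have "gradient q x = 2 *\<^sub>R proj S x" by (rule gradient_eqI[OF dq])
  finally have "norm (gradient (regularised_power S b \<epsilon>) x) = b * q x powr (- b / 2 - 1) * ynorm S x"
    using assms by (simp add: regularised_power_def[abs_def] q norm_proj)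
  then have "ynorm S x * norm (gradient (regularised_power S b \<epsilon>) x)
      = b * (q x powr (- b / 2 - 1) * (ynorm S x)\<^sup>2)"
    by (simp add: power2_eq_square)
  also have "\<dots> \<le> b * (q x powr (- b / 2 - 1) * q x)"
    using assms by (intro mult_left_mono) (auto simp: q)
  also have "q x powr (- b / 2 - 1) * q x = regularised_power S b \<epsilon> x"
    using qpos by (simp add: regularised_power_def q powr_diff)
  finally show ?thesis .
qed

text \<open>
  The squared radius \<open>3\<close> of the support of the cut-off keeps it bounded below on the product of the unit balls in \<open>y\<close> and \<open>z\<close>,
  where \<open>\<bar>x\<bar>\<^sup>2 \<le> 2\<close>.
\<close>

definition near_extremal :: "'n::finite set \<Rightarrow> real \<Rightarrow> real \<Rightarrow> real ^ 'n \<Rightarrow> real" where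
  "near_extremal S b \<epsilon> x = regularised_power S b \<epsilon> x * bump 3 x"

lemma test_function_near_extremal:
  assumes "0 < \<epsilon>"
  shows "test_function (near_extremal S b \<epsilon>)"
  by (rule test_functionI[where R = 3])
    (use assms in \<open>auto simp: near_extremal_def[abs_def] bump_eq_0_norm intro!: C_k_mult C_k_regularised_power C_k_bump\<close>)

lemma near_extremal_nonneg: "0 \<le> near_extremal S b \<epsilon> x"
  by (simp add: near_extremal_def regularised_power_def bump_bounds)

lemma weighted_integral_near_extremal_finite:
  fixes S :: "'n::finite set" and p \<alpha> :: real
  assumes "0 < \<epsilon>" "0 \<le> b" "0 < p" "0 < \<alpha> + card S"
  shows "weighted_integral S p \<alpha> (near_extremal S b \<epsilon>) < \<infinity>"
proof -
  define c where "c = \<epsilon> powr (- b / 2)"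
  have [measurable]: "cball (0 :: real ^ 'n) 3 \<in> sets borel" by simp
  have "weighted_integral S p \<alpha> (near_extremal S b \<epsilon>)
      \<le> (\<integral>\<^sup>+x. ennreal (c powr p) * ennreal (ynorm S x powr \<alpha> * indicat_real (cball 0 3) x) \<partial>lborel)"
    unfolding weighted_integral_def
  proof (intro nn_integral_mono)
    fix x
    show "ennreal (norm (near_extremal S b \<epsilon> x) powr p * ynorm S x powr \<alpha>)
        \<le> ennreal (c powr p) * ennreal (ynorm S x powr \<alpha> * indicat_real (cball 0 3) x)"
    proof (cases "x \<in> cball 0 3")
      case True
      have "near_extremal S b \<epsilon> x \<le> c * 1"
        unfolding near_extremal_def c_def using assms
        by (intro mult_mono regularised_power_le_const bump_bounds) auto
      then have "norm (near_extremal S b \<epsilon> x) powr p \<le> c powr p"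
        using assms near_extremal_nonneg[of S b \<epsilon> x] by (intro powr_mono2) auto
      then show ?thesis
        using True by (auto intro!: ennreal_leI mult_right_mono simp flip: ennreal_mult)
    next
      case False
      then have "near_extremal S b \<epsilon> x = 0"
        by (simp add: near_extremal_def bump_eq_0_norm)
      then show ?thesis using assms by simp
    qed
  qed
  also have "\<dots> = ennreal (c powr p) * (\<integral>\<^sup>+x. ennreal (ynorm S x powr \<alpha> * indicat_real (cball 0 3) x) \<partial>lborel)"
    by (intro nn_integral_cmult) measurable
  also have "\<dots> < \<infinity>"
    using ynorm_powr_locally_integrable[OF assms(4), of 3] by (simp add: ennreal_mult_less_top)
  finally show ?thesis .
qed

text \<open>
  The remainder \<open>M\<close> comes from the gradient of the cut-off. It does not depend on \<open>\<epsilon>\<close> because there the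
  regularised power may be replaced by \<open>\<bar>y\<bar> powr - b\<close>: the factor \<open>\<bar>y\<bar> powr p\<close>, no longer consumed by a
  differentiated power, lifts the exponent from the critical \<open>- k\<close> to \<open>p - k\<close>.
\<close>

lemma near_extremal_energy:
  fixes S :: "'n::finite set" and p \<alpha> :: real
  assumes p: "1 < p" and pos: "0 < \<alpha> + card S" and \<eta>: "0 < \<eta>"
  defines "b \<equiv> (\<alpha> + card S) / p"
  shows "\<exists>M<\<infinity>. \<forall>\<epsilon>>0. weighted_integral S p (\<alpha> + p) (gradient (near_extremal S b \<epsilon>))
    \<le> ennreal ((1 + \<eta>) powr p * b powr p) * weighted_integral S p \<alpha> (near_extremal S b \<epsilon>) + M"
proof -
  have b: "0 < b" using p pos by (simp add: b_def)
  have bp: "b * p = \<alpha> + card S" using p by (simp add: b_def)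
  obtain R B where RB: "0 < R" "0 < B" "\<And>x. norm (gradient (bump 3 :: real ^ 'n \<Rightarrow> real) x) \<le> B * indicat_real (cball 0 R) x"
    using test_function_gradient_bounded[OF test_function_bump[of 3]] by auto
  have [measurable]: "cball (0 :: real ^ 'n) R \<in> sets borel" by simp
  define c where "c = (1 + 1 / \<eta>) powr p * B powr p"
  define I where "I = (\<integral>\<^sup>+(x :: real ^ 'n). ennreal (ynorm S x powr (p - card S) * indicat_real (cball 0 R) x) \<partial>lborel)"
  have "I < \<infinity>"
    unfolding I_def using p by (intro ynorm_powr_locally_integrable) simp
  then have M: "ennreal c * I < \<infinity>" by (simp add: ennreal_mult_less_top)
  have "weighted_integral S p (\<alpha> + p) (gradient (near_extremal S b \<epsilon>))
    \<le> ennreal ((1 + \<eta>) powr p * b powr p) * weighted_integral S p \<alpha> (near_extremal S b \<epsilon>) + ennreal c * I"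
    if \<epsilon>: "0 < \<epsilon>" for \<epsilon>
  proof -
    let ?u = "near_extremal S b \<epsilon>" and ?w = "regularised_power S b \<epsilon>"
    have [measurable]: "?u \<in> borel_measurable borel"
      using test_function_continuous[OF test_function_near_extremal[OF \<epsilon>]]
      by (rule borel_measurable_continuous_onI)
    have pt: "norm (gradient ?u x) powr p * ynorm S x powr (\<alpha> + p)
      \<le> ((1 + \<eta>) powr p * b powr p) * (norm (?u x) powr p * ynorm S x powr \<alpha>)
        + c * (ynorm S x powr (p - card S) * indicat_real (cball 0 R) x)" for x
    proof (cases "ynorm S x = 0")
      case False
      then have y: "0 < ynorm S x" using ynorm_nonneg[of S x] by linarith
      define V where "V = ynorm S x powr - b * (B * indicat_real (cball 0 R) x) * ynorm S x"
      have V0: "0 \<le> V" using RB y by (simp add: V_def)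
      have dw: "?w differentiable (at x)" 
        by (rule C_k_differentiable[OF C_k_regularised_power[OF \<epsilon>]])
      have dchi: "bump 3 differentiable (at x)"
        by (rule test_function_differentiable[OF test_function_bump]) simp
      have "norm (gradient ?u x) = norm (?w x *\<^sub>R gradient (bump 3) x + bump 3 x *\<^sub>R gradient ?w x)"
        unfolding near_extremal_def[abs_def] by (simp add: gradient_mult[OF dw dchi])
      also have "\<dots> \<le> ?w x * norm (gradient (bump 3) x) + bump 3 x * norm (gradient ?w x)"
        using norm_triangle_ineq[of "?w x *\<^sub>R gradient (bump 3) x" "bump 3 x *\<^sub>R gradient ?w x"]
        by (simp add: abs_of_pos[OF regularised_power_pos[OF \<epsilon>]] bump_bounds)
      finally have "norm (gradient ?u x) * ynorm S x
          \<le> (?w x * norm (gradient (bump 3) x) + bump 3 x * norm (gradient ?w x)) * ynorm S x"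
        using y by (intro mult_right_mono) auto
      also have "\<dots> = ?w x * norm (gradient (bump 3) x) * ynorm S x
          + bump 3 x * (ynorm S x * norm (gradient ?w x))"
        by (simp add: algebra_simps)
      also have "\<dots> \<le> V + bump 3 x * (b * ?w x)"
        unfolding V_def using y b RB(2) regularised_power_pos[OF \<epsilon>, of S b x]
        by (intro add_mono mult_mono mult_nonneg_nonneg mult_left_mono regularised_power_le \<epsilon> RB(3) False
          ynorm_gradient_regularised_power bump_bounds) auto
      also have "\<dots> = b * ?u x + V" by (simp add: near_extremal_def)
      finally have "(norm (gradient ?u x) * ynorm S x) powr p \<le> (b * ?u x + V) powr p"
        using p y by (intro powr_mono2) auto
      also have "\<dots> \<le> (1 + \<eta>) powr p * (b * ?u x) powr p + (1 + 1 / \<eta>) powr p * V powr p"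
        using b \<eta> p V0 by (intro powr_add_le) (auto simp: near_extremal_nonneg)
      finally have "(norm (gradient ?u x) * ynorm S x) powr p * ynorm S x powr \<alpha>
          \<le> ((1 + \<eta>) powr p * (b * ?u x) powr p + (1 + 1 / \<eta>) powr p * V powr p) * ynorm S x powr \<alpha>"
        by (rule mult_right_mono) simp
      moreover have "V powr p * ynorm S x powr \<alpha>
          = B powr p * (ynorm S x powr (p - card S) * indicat_real (cball 0 R) x)"
      proof -
        have "p * b = \<alpha> + card S" using bp by (simp add: mult.commute)
        then have "(ynorm S x powr - b) powr p * ynorm S x powr p * ynorm S x powr \<alpha> = ynorm S x powr (p - card S)"
          using y by (simp add: powr_powr mult.commute flip: powr_add)
        then show ?thesis
          using p RB y by (simp add: V_def powr_mult ac_simps split: split_indicator)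
      qed
      moreover have "(norm (gradient ?u x) * ynorm S x) powr p * ynorm S x powr \<alpha>
          = norm (gradient ?u x) powr p * ynorm S x powr (\<alpha> + p)"
        by (simp add: powr_mult powr_add ynorm_nonneg)
      moreover have "(b * ?u x) powr p = b powr p * norm (?u x) powr p"
        using b by (simp add: powr_mult near_extremal_nonneg)
      ultimately show ?thesis
        by (simp add: c_def distrib_right mult.assoc)
    qed (use RB p \<eta> in \<open>simp add: c_def\<close>)
    have "weighted_integral S p (\<alpha> + p) (gradient ?u)
      \<le> (\<integral>\<^sup>+x. ennreal ((1 + \<eta>) powr p * b powr p) * ennreal (norm (?u x) powr p * ynorm S x powr \<alpha>)
        + ennreal c * ennreal (ynorm S x powr (p - card S) * indicat_real (cball 0 R) x) \<partial>lborel)"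
      unfolding weighted_integral_def
    proof (intro nn_integral_mono)
      fix x
      show "ennreal (norm (gradient ?u x) powr p * ynorm S x powr (\<alpha> + p))
        \<le> ennreal ((1 + \<eta>) powr p * b powr p) * ennreal (norm (?u x) powr p * ynorm S x powr \<alpha>)
        + ennreal c * ennreal (ynorm S x powr (p - card S) * indicat_real (cball 0 R) x)"
        using ennreal_leI[OF pt[of x]]
        by (simp add: ennreal_mult ennreal_plus c_def)
    qed
    also have "\<dots> = ennreal ((1 + \<eta>) powr p * b powr p) * weighted_integral S p \<alpha> ?u + ennreal c * I"
      unfolding weighted_integral_def I_def
      by (subst nn_integral_add) (auto simp: nn_integral_cmult)
    finally show ?thesis .
  qed
  with M show ?thesis by blast
qed

text \<open>
  As \<open>\<epsilon>\<close> tends to \<open>0\<close> the integrands converge to \<open>\<chi> powr p * \<bar>y\<bar> powr - k\<close>, whose integral is infinite; by Fatou's lemma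
  the integrals cannot stay below a finite \<open>K\<close>.
\<close>

lemma near_extremal_unbounded:
  fixes S :: "'n::finite set" and p \<alpha> :: real
  assumes S: "S \<noteq> {}" and p: "1 < p" and pos: "0 < \<alpha> + card S" and K: "K < \<infinity>"
  defines "b \<equiv> (\<alpha> + card S) / p"
  shows "\<exists>\<epsilon>>0. K < weighted_integral S p \<alpha> (near_extremal S b \<epsilon>)"
proof (rule ccontr)
  assume "\<not> ?thesis"
  then have le: "weighted_integral S p \<alpha> (near_extremal S b \<epsilon>) \<le> K" if "0 < \<epsilon>" for \<epsilon>
    using that by (metis not_less)
  have b: "0 < b" using p pos by (simp add: b_def)
  have bp: "p * b = \<alpha> + card S" using p by (simp add: b_def)
  define e where "e n = 1 / real (Suc n)" for n
  have e: "0 < e n" for n by (simp add: e_def)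
  define f where "f n x = ennreal (norm (near_extremal S b (e n) x) powr p * ynorm S x powr \<alpha>)" for n and x :: "real ^ 'n"
  define g where "g x = ennreal (bump 3 x powr p * ynorm S x powr - real (card S))" for x :: "real ^ 'n"
  have [measurable]: "near_extremal S b (e n) \<in> borel_measurable borel" for n
    using test_function_continuous[OF test_function_near_extremal[OF e]]
    by (rule borel_measurable_continuous_onI)
  have f_meas: "f n \<in> borel_measurable lborel" for n
    unfolding f_def by measurable
  have [measurable]: "(bump 3 :: real ^ 'n \<Rightarrow> real) \<in> borel_measurable borel"
    by (intro borel_measurable_continuous_onI test_function_continuous test_function_bump) simp
  have lim: "(\<lambda>n. f n x) \<longlonglongrightarrow> g x" for x
  proof (cases "ynorm S x = 0")
    case False
    then have y: "0 < ynorm S x" using ynorm_nonneg[of S x] by linarith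
    have "(\<lambda>n. e n + (ynorm S x)\<^sup>2) \<longlonglongrightarrow> 0 + (ynorm S x)\<^sup>2"
      unfolding e_def by (intro tendsto_add tendsto_const LIMSEQ_Suc lim_1_over_n)
    then have "(\<lambda>n. ennreal (\<bar>(e n + (ynorm S x)\<^sup>2) powr (- b / 2) * bump 3 x\<bar> powr p * ynorm S x powr \<alpha>))
       \<longlonglongrightarrow> ennreal (\<bar>((0 + (ynorm S x)\<^sup>2) powr (- b / 2)) * bump 3 x\<bar> powr p * ynorm S x powr \<alpha>)"
      using y p by (intro tendsto_ennrealI tendsto_mult tendsto_powr' tendsto_powr tendsto_const tendsto_rabs) auto
    moreover have "\<bar>((0 + (ynorm S x)\<^sup>2) powr (- b / 2)) * bump 3 x\<bar> powr p * ynorm S x powr \<alpha>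
        = bump 3 x powr p * ynorm S x powr - real (card S)"
    proof -
      have "((ynorm S x)\<^sup>2) powr (- b / 2) = ynorm S x powr - b"
        by (rule sq_powr_half[OF ynorm_nonneg])
      moreover have "(ynorm S x powr - b) powr p * ynorm S x powr \<alpha> = ynorm S x powr - real (card S)"
        using y bp by (simp add: powr_powr mult.commute flip: powr_add)
      ultimately show ?thesis
        by (simp add: abs_mult bump_bounds powr_mult mult.assoc mult.left_commute)
    qed
    ultimately show ?thesis
      by (simp add: f_def g_def near_extremal_def regularised_power_def)
  qed (simp add: f_def g_def)
  have "(\<integral>\<^sup>+x. g x \<partial>lborel) = (\<integral>\<^sup>+x. liminf (\<lambda>n. f n x) \<partial>lborel)"
    using lim by (intro nn_integral_cong lim_imp_Liminf[symmetric]) auto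
  also have "\<dots> \<le> liminf (\<lambda>n. \<integral>\<^sup>+x. f n x \<partial>lborel)"
    by (rule nn_integral_liminf[OF f_meas])
  also have "\<dots> \<le> liminf (\<lambda>n. K)"
    using le[OF e] by (intro Liminf_mono) (auto simp: weighted_integral_def f_def)
  also have "\<dots> = K" by (simp add: Liminf_const)
  finally have gK: "(\<integral>\<^sup>+x. g x \<partial>lborel) \<le> K" .
  let ?Q = "{x. ynorm S x \<le> 1 \<and> ynorm (- S) x \<le> 1}"
  have "ennreal (exp (- 1) powr p) * \<infinity> = ennreal (exp (- 1) powr p) *
      (\<integral>\<^sup>+x. ennreal (ynorm S x powr (- real (card S)) * indicat_real ?Q x) \<partial>lborel)"
    by (simp add: ynorm_powr_critical_not_integrable[OF S])
  also have "\<dots> = (\<integral>\<^sup>+x. ennreal (exp (- 1) powr p) * ennreal (ynorm S x powr (- real (card S)) * indicat_real ?Q x) \<partial>lborel)"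
    by (intro nn_integral_cmult[symmetric]) measurable
  also have "\<dots> \<le> (\<integral>\<^sup>+x. g x \<partial>lborel)"
  proof (intro nn_integral_mono)
    fix x
    show "ennreal (exp (- 1) powr p) * ennreal (ynorm S x powr (- real (card S)) * indicat_real ?Q x) \<le> g x"
    proof (cases "x \<in> ?Q")
      case True
      have "x \<bullet> x = (\<Sum>i\<in>S. x $ i * x $ i) + (\<Sum>i\<in>- S. x $ i * x $ i)"
        using sum.union_disjoint[of S "- S" "\<lambda>i. x $ i * x $ i"] by (simp add: inner_vec_def Compl_partition)
      also have "\<dots> = (ynorm S x)\<^sup>2 + (ynorm (- S) x)\<^sup>2" by (simp only: ynorm_sq)
      also have "\<dots> \<le> 1 + 1"
        using True by (intro add_mono power_le_one ynorm_nonneg) auto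
      finally have "exp (- 1) \<le> bump 3 x" by (intro bump_ge) simp
      then have "exp (- 1) powr p \<le> bump 3 x powr p" using p by (intro powr_mono2) auto
      then show ?thesis
        using True by (auto simp: g_def intro!: ennreal_leI mult_right_mono simp flip: ennreal_mult)
    qed simp
  qed
  finally have "\<infinity> \<le> (\<integral>\<^sup>+x. g x \<partial>lborel)" by (simp add: ennreal_mult_top top_unique)
  with gK K show False by simp
qed

section \<open>Optimality of the constant\<close>

text \<open>
  If \<open>C\<close> were smaller, then for small \<open>\<eta>\<close> the inequality for \<open>u\<^sub>\<epsilon>\<close> and the energy bound would give
  \<open>l \<le> \<theta> l + C M\<close> with \<open>\<theta> < 1\<close> for the left-hand side \<open>l\<close>, hence a bound on \<open>l\<close> independent of \<open>\<epsilon>\<close>.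
\<close>

lemma hardy_constant_optimal:
  fixes S :: "'n::finite set" and p \<alpha> :: real
  assumes S: "S \<noteq> {}" and p: "1 < p" and pos: "0 < \<alpha> + card S"
  defines "b \<equiv> (\<alpha> + card S) / p"
  assumes hardy: "\<And>u :: real ^ 'n \<Rightarrow> real. test_function u \<Longrightarrow>
    weighted_integral S p \<alpha> u \<le> ennreal C * weighted_integral S p (\<alpha> + p) (gradient u)"
  shows "(1 / b) powr p \<le> C"
proof (rule ccontr)
  assume "\<not> ?thesis"
  then have C: "C < (1 / b) powr p" by simp
  have b: "0 < b" using p pos by (simp add: b_def)
  \<comment> \<open>A negative \<open>C\<close> enters the inequality as \<open>ennreal C = 0\<close>.\<close>
  define D where "D = max 0 C"
  have D: "0 \<le> D" "ennreal C = ennreal D" by (auto simp: D_def max_def ennreal_neg)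
  have "D < (1 / b) powr p" using C b by (simp add: D_def)
  then have "D * b powr p < (1 / b) powr p * b powr p"
    using b by (intro mult_strict_right_mono) auto
  also have "\<dots> = 1" using b by (simp flip: powr_mult)
  finally have Db: "D * b powr p < 1" .
  have "((\<lambda>\<eta>. D * ((1 + \<eta>) powr p * b powr p)) \<longlongrightarrow> D * ((1 + 0) powr p * b powr p)) (at_right 0)"
    by (intro tendsto_intros) auto
  then have "\<forall>\<^sub>F \<eta> in at_right 0. D * ((1 + \<eta>) powr p * b powr p) < 1"
    using Db by (intro order_tendstoD) auto
  then have "\<exists>\<eta>>0. D * ((1 + \<eta>) powr p * b powr p) < 1"
    unfolding eventually_at_right_field by (meson dense)
  then obtain \<eta> where \<eta>: "0 < \<eta>" "D * ((1 + \<eta>) powr p * b powr p) < 1" by blast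
  define \<theta> where "\<theta> = D * ((1 + \<eta>) powr p * b powr p)"
  have \<theta>: "0 \<le> \<theta>" "\<theta> < 1" using D \<eta> by (auto simp: \<theta>_def)
  obtain M where M: "M < \<infinity>" and energy: "\<And>\<epsilon>. 0 < \<epsilon> \<Longrightarrow>
      weighted_integral S p (\<alpha> + p) (gradient (near_extremal S b \<epsilon>))
      \<le> ennreal ((1 + \<eta>) powr p * b powr p) * weighted_integral S p \<alpha> (near_extremal S b \<epsilon>) + M"
    using near_extremal_energy[OF p pos \<eta>(1)] unfolding b_def by blast
  obtain m where m: "M = ennreal m" "0 \<le> m" using M by (cases M) auto
  obtain \<epsilon> where \<epsilon>: "0 < \<epsilon>" and large: "ennreal (D * m / (1 - \<theta>)) < weighted_integral S p \<alpha> (near_extremal S b \<epsilon>)"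
    using near_extremal_unbounded[OF S p pos, of "ennreal (D * m / (1 - \<theta>))"] unfolding b_def by auto
  have "weighted_integral S p \<alpha> (near_extremal S b \<epsilon>) < \<infinity>"
    using \<epsilon> b p pos by (intro weighted_integral_near_extremal_finite) auto
  then obtain l where l: "weighted_integral S p \<alpha> (near_extremal S b \<epsilon>) = ennreal l" "0 \<le> l"
    by (cases "weighted_integral S p \<alpha> (near_extremal S b \<epsilon>)") auto
  have "ennreal l \<le> ennreal D * (ennreal ((1 + \<eta>) powr p * b powr p) * ennreal l + ennreal m)"
    using hardy[OF test_function_near_extremal[OF \<epsilon>], of S b] mult_left_mono[OF energy[OF \<epsilon>], of "ennreal D"]
    unfolding l(1) m(1) D(2) by (auto intro: order_trans)
  also have "\<dots> = ennreal (\<theta> * l + D * m)"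
    using D l m by (simp add: \<theta>_def algebra_simps flip: ennreal_mult ennreal_plus)
  finally have "l \<le> \<theta> * l + D * m"
    using \<theta> l m D by (subst (asm) ennreal_le_iff) auto
  then have "l \<le> D * m / (1 - \<theta>)" using \<theta> by (simp add: field_simps)
  moreover have "D * m / (1 - \<theta>) < l"
    using large D m \<theta> unfolding l(1) by (subst (asm) ennreal_less_iff) auto
  ultimately show False by simp
qed

theorem theorem2p1:
  fixes S :: "'n::finite set" and k :: nat and p \<alpha> :: real
  assumes "1 \<le> k" and "k \<le> CARD('n)" and "card S = k"
    and "1 < p" and "\<alpha> + real k > 0"
  shows "(\<forall>u :: real ^ 'n \<Rightarrow> real. test_function u \<longrightarrow>
            weighted_integral S p \<alpha> u
              \<le> ennreal (p powr p / (\<alpha> + real k) powr p) * weighted_integral S p (\<alpha> + p) (gradient u))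
       \<and> (\<forall>C :: real. C < p powr p / (\<alpha> + real k) powr p \<longrightarrow>
            \<not> (\<forall>u :: real ^ 'n \<Rightarrow> real. test_function u \<longrightarrow>
                 weighted_integral S p \<alpha> u
                   \<le> ennreal C * weighted_integral S p (\<alpha> + p) (gradient u)))"
proof -
  have S: "S \<noteq> {}" using assms(1,3) by auto
  have pos: "0 < \<alpha> + card S" using assms(3,5) by simp
  have const: "(1 / ((\<alpha> + card S) / p)) powr p = p powr p / (\<alpha> + real k) powr p"
    using assms(3,4,5) by (simp add: powr_divide)
  show ?thesis
    using weighted_hardy_inequality[OF _ \<open>1 < p\<close> pos]
      hardy_constant_optimal[OF S \<open>1 < p\<close> pos]
    unfolding const by (meson not_le)
qed

end
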